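(* Let $(G,C)$ be an edge-colored graph of order $n\geq 4$ such that $|CN(u)\cup CN(v)|\geq n$ for every pair of distinct vertices $u,v\in V(G)$. Then $G$ contains at least $\frac{n^2-2n}{24}$ rainbow triangles.
   Context: All graphs are finite, undirected and simple. An edge-colored graph $(G,C)$ is a graph $G$ with an arbitrary function $C:E(G)\to\mathbb{N}$ (not necessarily a proper coloring). For a vertex $v$, $CN(v)$ is the set of colors appearing on edges incident with $v$. A triangle is rainbow if its three edges have pairwise distinct colors. *)

theory Defs
  imports Complex_Main
begin

definition simple_graph :: "'a set \<Rightarrow> 'a set set \<Rightarrow> bool" where
  "simple_graph V E \<longleftrightarrow> finite V \<and> (\<forall>e\<in>E. e \<subseteq> V \<and> card e = 2)"

(* An edge coloring is a total function on vertex sets, of which only the values on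
   members of E are ever used; nothing is assumed about it. *)
definition color_nbhd :: "'a set set \<Rightarrow> ('a set \<Rightarrow> nat) \<Rightarrow> 'a \<Rightarrow> nat set" where
  "color_nbhd E C v = C ` {e \<in> E. v \<in> e}"

definition triangle :: "'a set set \<Rightarrow> 'a \<Rightarrow> 'a \<Rightarrow> 'a \<Rightarrow> bool" where
  "triangle E x y z \<longleftrightarrow>
     distinct [x, y, z] \<and> {x, y} \<in> E \<and> {y, z} \<in> E \<and> {x, z} \<in> E"

(* Triangles are counted as subgraphs, not as ordered triples: in a simple graph a
   triangle is determined by its set of three vertices. *)
definition rainbow_triangles :: "'a set set \<Rightarrow> ('a set \<Rightarrow> nat) \<Rightarrow> 'a set set" where
  "rainbow_triangles E C =
     {{x, y, z} | x y z. triangle E x y z \<and> distinct [C {x, y}, C {y, z}, C {x, z}]}"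

end

theory Submission
  imports Defs
begin

text \<open>
  Write \<open>d v\<close> for the number of colors at \<open>v\<close> and \<open>deg v\<close> for its degree, so that the
  excess \<open>g v = deg v - d v\<close> measures how far the edges at \<open>v\<close> are from being pairwise
  differently colored.  The proof is a double count of ordered triples \<open>(v, x, y)\<close> spanning a
  triangle with \<open>C {x, y} \<noteq> C {v, x}\<close>.

  For an edge \<open>{v, x}\<close>, the colors at \<open>x\<close> that are not seen on edges from \<open>x\<close> to
  non-neighbors of \<open>v\<close> have to be seen on edges from \<open>x\<close> to neighbors of \<open>v\<close>; this gives at
  least \<open>d x + deg v - n\<close> vertices \<open>y\<close>
  (lemma \<open>colors_le_third_vertices\<close>).  A triple that is not rainbow repeats a color
  at \<open>v\<close> or at \<open>y\<close>, and a vertex is the apex of at most \<open>g v * (g v + 1)\<close> ordered pairs of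
  equally colored edges (lemma \<open>card_mono_pairs_le\<close>).  The point of using \<open>deg v\<close> and not
  \<open>d v\<close> in the first bound is that the resulting extra term \<open>deg v * g v\<close> nearly pays for the
  \<open>2 * g v * (g v + 1)\<close> pairs lost on account of the apex \<open>v\<close>.  Since a rainbow triangle gives
  six triples, six times the number of rainbow triangles is at least the sum over all \<open>v\<close> of
  \<open>(\<Sum>x\<in>N v. d x + d v - n) - g v * (n + 1 - 2 * d v)\<close>  (lemma \<open>sum_net_le_rainbow\<close>).

  The neighborhood union condition gives \<open>d u + d v \<ge> n\<close> for distinct vertices, and
  \<open>d u + d v \<ge> n + 1\<close> for adjacent ones because these share the color of their edge.  If
  \<open>2 * d v \<ge> n\<close> throughout, each summand is at least \<open>deg v - g v = d v \<ge> n / 2\<close>, which is more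
  than enough.  Otherwise some \<open>w\<close> has \<open>2 * d w < n\<close>; its summand may be negative,
  but every other vertex then has at least \<open>n - d w > n / 2\<close> colors, and this surplus
  outweighs the loss at \<open>w\<close>.
\<close>

section \<open>Neighborhoods and colors\<close>

locale edge_colored_graph =
  fixes V :: "'a set" and E :: "'a set set" and C :: "'a set \<Rightarrow> nat"
  assumes simple: "simple_graph V E"
begin

definition N :: "'a \<Rightarrow> 'a set" where "N v = {x. {v, x} \<in> E}"

definition deg :: "'a \<Rightarrow> nat" where "deg v = card (N v)"

definition color_deg :: "'a \<Rightarrow> nat" where "color_deg v = card (color_nbhd E C v)"

lemma finite_V: "finite V"
  using simple by (simp add: simple_graph_def)

lemma edge_distinct: "{a, b} \<in> E \<Longrightarrow> a \<noteq> b"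
  using simple by (force simp: simple_graph_def)

lemma N_subset: "N v \<subseteq> V"
  using simple by (auto simp: simple_graph_def N_def)

lemma finite_N: "finite (N v)"
  using N_subset finite_V finite_subset by blast

lemma N_sym: "x \<in> N v \<longleftrightarrow> v \<in> N x"
  by (simp add: N_def insert_commute)

lemma not_in_own_N: "v \<notin> N v"
  using edge_distinct[of v v] by (auto simp: N_def)

lemma deg_less: "v \<in> V \<Longrightarrow> deg v < card V"
  unfolding deg_def using N_subset not_in_own_N finite_V by (metis psubsetI psubset_card_mono)

lemma color_nbhd_eq: "color_nbhd E C v = (\<lambda>x. C {v, x}) ` N v"
proof -
  have "e \<in> (\<lambda>x. {v, x}) ` N v" if "e \<in> E" "v \<in> e" for e
  proof -
    from that simple have "card e = 2" by (simp add: simple_graph_def)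
    then obtain a b where "e = {a, b}" by (auto simp: card_2_iff)
    with that show ?thesis by (auto simp: N_def insert_commute)
  qed
  then have "{e \<in> E. v \<in> e} = (\<lambda>x. {v, x}) ` N v" by (auto simp: N_def)
  then show ?thesis by (simp add: color_nbhd_def image_image)
qed

lemma finite_color_nbhd: "finite (color_nbhd E C v)"
  by (simp add: color_nbhd_eq finite_N)

lemma color_deg_le_deg: "color_deg v \<le> deg v"
  unfolding color_deg_def deg_def color_nbhd_eq by (rule card_image_le[OF finite_N])

section \<open>Ordered triples\<close>

text \<open>Every color at \<open>x\<close> is seen on the edge to \<open>v\<close>, on an edge to another vertex outside
  \<open>N v\<close>, or on an edge to one of the vertices counted on the right.  At most \<open>card V - deg v\<close>
  colors are of the first two kinds, as \<open>v\<close> itself lies outside \<open>N v\<close>.\<close>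

lemma colors_le_third_vertices:
  assumes "x \<in> N v"
  shows "color_deg x + deg v \<le> card V + card {y \<in> N v \<inter> N x. C {x, y} \<noteq> C {v, x}}"
proof -
  let ?S = "{y \<in> N v \<inter> N x. C {x, y} \<noteq> C {v, x}}"
  let ?f = "\<lambda>y. C {x, y}"
  have v: "v \<in> N x - N v" using assms N_sym not_in_own_N by blast
  have "?f y \<in> ?f ` (?S \<union> (N x - N v))" if "y \<in> N x" for y
  proof (cases "y \<in> N v \<and> C {x, y} = C {v, x}")
    case True
    then have "?f y = ?f v" by (simp add: insert_commute)
    with v show ?thesis by blast
  next
    case False
    with that show ?thesis by blast
  qed
  then have "color_nbhd E C x \<subseteq> ?f ` (?S \<union> (N x - N v))"
    by (auto simp: color_nbhd_eq)
  then have "color_deg x \<le> card (?S \<union> (N x - N v))"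
    unfolding color_deg_def by (rule surj_card_le[rotated]) (simp add: finite_N)
  also have "\<dots> \<le> card ?S + card (N x - N v)" by (rule card_Un_le)
  also have "card (N x - N v) \<le> card (V - N v)"
    using N_subset finite_V by (intro card_mono) auto
  also have "card (V - N v) = card V - deg v"
    by (simp add: deg_def card_Diff_subset finite_N N_subset)
  finally have "color_deg x \<le> card ?S + (card V - deg v)" by simp
  moreover have "deg v \<le> card V"
    unfolding deg_def by (rule card_mono[OF finite_V N_subset])
  ultimately show ?thesis by linarith
qed

definition mono_pairs :: "'a \<Rightarrow> ('a \<times> 'a) set" where
  "mono_pairs v = {(x, y). x \<in> N v \<and> y \<in> N v \<and> x \<noteq> y \<and> C {v, x} = C {v, y}}"

lemma finite_mono_pairs: "finite (mono_pairs v)"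
  by (rule finite_subset[of _ "N v \<times> N v"]) (auto simp: mono_pairs_def finite_N)

text \<open>A color class of size \<open>s\<close> at \<open>v\<close> contributes \<open>s * (s - 1)\<close> pairs.  Since each class is
  nonempty, the excesses \<open>s - 1\<close> sum to \<open>deg v - color_deg v\<close>; this bounds each
  single one of them as well.\<close>

lemma card_mono_pairs_le:
  "card (mono_pairs v) \<le> (deg v - color_deg v) * (deg v - color_deg v + 1)"
proof -
  define K where "K c = {x \<in> N v. C {v, x} = c}" for c
  let ?CN = "color_nbhd E C v"
  define g where "g = deg v - color_deg v"
  have finK: "finite (K c)" for c by (simp add: K_def finite_N)
  have pos: "1 \<le> card (K c)" if "c \<in> ?CN" for c
  proof -
    from that have "K c \<noteq> {}" by (auto simp: K_def color_nbhd_eq)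
    then show ?thesis using finK[of c] by (simp add: Suc_le_eq card_gt_0_iff)
  qed
  have "N v = (\<Union>c\<in>?CN. K c)" by (auto simp: K_def color_nbhd_eq)
  then have "deg v = card (\<Union>c\<in>?CN. K c)" by (simp add: deg_def)
  also have "\<dots> = (\<Sum>c\<in>?CN. card (K c))"
    by (rule card_UN_disjoint) (auto simp: finite_color_nbhd finK, auto simp: K_def)
  finally have excess: "(\<Sum>c\<in>?CN. card (K c) - 1) = g"
    using pos by (simp add: sum_subtractf_nat g_def color_deg_def)
  have single: "card (K c) - 1 \<le> g" if "c \<in> ?CN" for c
    unfolding excess[symmetric] by (rule member_le_sum[OF that]) (auto simp: finite_color_nbhd)
  have "mono_pairs v \<subseteq> (\<Union>c\<in>?CN. Sigma (K c) (\<lambda>x. K c - {x}))"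
    by (auto simp: mono_pairs_def K_def color_nbhd_eq)
  then have "card (mono_pairs v) \<le> card (\<Union>c\<in>?CN. Sigma (K c) (\<lambda>x. K c - {x}))"
    by (intro card_mono) (auto simp: finite_color_nbhd finK)
  also have "\<dots> \<le> (\<Sum>c\<in>?CN. card (Sigma (K c) (\<lambda>x. K c - {x})))"
    by (rule card_UN_le[OF finite_color_nbhd])
  also have "\<dots> = (\<Sum>c\<in>?CN. (card (K c) - 1) * card (K c))"
    by (rule sum.cong) (simp_all add: card_SigmaI finK mult.commute)
  also have "\<dots> \<le> (\<Sum>c\<in>?CN. (card (K c) - 1) * (g + 1))"
  proof (intro sum_mono mult_left_mono)
    fix c assume "c \<in> ?CN"
    then show "card (K c) \<le> g + 1" using single by fastforce
  qed simp
  also have "\<dots> = g * (g + 1)" by (simp only: excess flip: sum_distrib_right)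
  finally show ?thesis by (simp add: g_def)
qed

definition rainbow_triples :: "('a \<times> 'a \<times> 'a) set" where
  "rainbow_triples = {(v, x, y). triangle E v x y \<and> distinct [C {v, x}, C {x, y}, C {v, y}]}"

lemma rainbow_triples_subset: "rainbow_triples \<subseteq> V \<times> V \<times> V"
  using simple by (auto simp: rainbow_triples_def triangle_def simple_graph_def)

lemma card_rainbow_triples_le: "card rainbow_triples \<le> 6 * card (rainbow_triangles E C)"
proof -
  define P where "P T = {(a, b, c). T = {a, b, c} \<and> distinct [a, b, c]}" for T :: "'a set"
  have "rainbow_triangles E C \<subseteq> Pow V"
    using simple by (auto simp: rainbow_triangles_def triangle_def simple_graph_def)
  then have fin: "finite (rainbow_triangles E C)"
    by (rule finite_subset) (simp add: finite_V)
  have P: "finite (P T) \<and> card (P T) \<le> 6" if T: "T \<in> rainbow_triangles E C" for T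
  proof -
    from T obtain p q r where T: "T = {p, q, r}" by (auto simp: rainbow_triangles_def)
    have sub: "P T \<subseteq> set [(p,q,r), (p,r,q), (q,p,r), (q,r,p), (r,p,q), (r,q,p)]" (is "_ \<subseteq> set ?L")
    proof
      fix t assume "t \<in> P T"
      then obtain a b c where t: "t = (a, b, c)" "{a, b, c} = {p, q, r}" "distinct [a, b, c]"
        using T by (auto simp: P_def)
      then have "a \<in> {p, q, r}" "b \<in> {p, q, r}" "c \<in> {p, q, r}" by blast+
      with t show "t \<in> set ?L" by auto
    qed
    have "card (P T) \<le> card (set ?L)" by (rule card_mono[OF _ sub]) simp
    also have "\<dots> \<le> length ?L" by (rule card_length)
    finally have "card (P T) \<le> 6" by simp
    moreover have "finite (P T)" by (rule finite_subset[OF sub]) simp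
    ultimately show ?thesis by simp
  qed
  have "rainbow_triples \<subseteq> (\<Union>T\<in>rainbow_triangles E C. P T)"
    unfolding rainbow_triples_def rainbow_triangles_def P_def triangle_def by blast
  then have "card rainbow_triples \<le> card (\<Union>T\<in>rainbow_triangles E C. P T)"
    by (rule card_mono[rotated]) (use fin P in auto)
  also have "\<dots> \<le> (\<Sum>T\<in>rainbow_triangles E C. card (P T))" by (rule card_UN_le[OF fin])
  also have "\<dots> \<le> (\<Sum>T\<in>rainbow_triangles E C. 6)" by (rule sum_mono) (use P in auto)
  finally show ?thesis by (simp add: mult.commute)
qed

text \<open>The double count.  A triple \<open>(v, x, y)\<close> with \<open>C {x, y} \<noteq> C {v, x}\<close> fails to be rainbow
  only through a pair of equally colored edges at \<open>v\<close> or at \<open>y\<close>, whence the factor 2.\<close>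

lemma sum_third_vertices_le:
  "(\<Sum>v\<in>V. \<Sum>x\<in>N v. card {y \<in> N v \<inter> N x. C {x, y} \<noteq> C {v, x}})
     \<le> card rainbow_triples + 2 * (\<Sum>v\<in>V. card (mono_pairs v))"
proof -
  define S where "S v x = {y \<in> N v \<inter> N x. C {x, y} \<noteq> C {v, x}}" for v x
  define A where "A = (SIGMA v:V. SIGMA x:N v. S v x)"
  define M where "M = (SIGMA v:V. mono_pairs v)"
  have finS: "finite (S v x)" for v x by (simp add: S_def finite_N)
  have cardA: "card A = (\<Sum>v\<in>V. \<Sum>x\<in>N v. card (S v x))"
    by (simp add: A_def card_SigmaI finite_V finite_N finS)
  have cardM: "card M = (\<Sum>v\<in>V. card (mono_pairs v))"
    by (simp add: M_def card_SigmaI finite_V finite_mono_pairs)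
  have finM: "finite M" by (simp add: M_def finite_V finite_mono_pairs)
  have finR: "finite rainbow_triples"
    by (rule finite_subset[OF rainbow_triples_subset]) (simp add: finite_V)
  \<comment> \<open>Move the apex of a pair in \<open>M\<close> to the last place of the triple.\<close>
  let ?rot = "\<lambda>(a, b, c). (b, c, a)"
  have "A \<subseteq> rainbow_triples \<union> (M \<union> ?rot ` M)"
  proof
    fix t assume "t \<in> A"
    then obtain v x y where t: "t = (v, x, y)" and V: "v \<in> V" and x: "x \<in> N v"
      and y: "y \<in> N v" "y \<in> N x" and col: "C {x, y} \<noteq> C {v, x}"
      by (auto simp: A_def S_def)
    have E: "{v, x} \<in> E" "{x, y} \<in> E" "{v, y} \<in> E" using x y by (auto simp: N_def)
    have dist: "v \<noteq> x" "x \<noteq> y" "v \<noteq> y" using E edge_distinct by auto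
    consider "C {v, x} = C {v, y}" | "C {x, y} = C {v, y}"
      | "C {v, x} \<noteq> C {v, y}" "C {x, y} \<noteq> C {v, y}" by blast
    then show "t \<in> rainbow_triples \<union> (M \<union> ?rot ` M)"
    proof cases
      case 1
      then have "t \<in> M" using t V x y dist by (simp add: M_def mono_pairs_def)
      then show ?thesis by simp
    next
      case 2
      have "y \<in> V" using y N_subset by blast
      then have "(y, v, x) \<in> M"
        using 2 y dist N_sym[of v y] N_sym[of x y]
        by (simp add: M_def mono_pairs_def insert_commute)
      then have "?rot (y, v, x) \<in> ?rot ` M" by (rule imageI)
      then show ?thesis using t by simp
    next
      case 3
      then have "t \<in> rainbow_triples"
        using t E dist col by (simp add: rainbow_triples_def triangle_def)
      then show ?thesis by simp
    qed
  qed
  then have "card A \<le> card (rainbow_triples \<union> (M \<union> ?rot ` M))"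
    by (rule card_mono[rotated]) (use finM finR in simp)
  also have "\<dots> \<le> card rainbow_triples + card (M \<union> ?rot ` M)" by (rule card_Un_le)
  also have "card (M \<union> ?rot ` M) \<le> card M + card (?rot ` M)" by (rule card_Un_le)
  also have "card (?rot ` M) \<le> card M" by (rule card_image_le[OF finM])
  finally show ?thesis using cardA cardM by (simp add: S_def)
qed

section \<open>A lower bound vertex by vertex\<close>

definition net :: "'a \<Rightarrow> int" where
  "net v = (\<Sum>x\<in>N v. int (color_deg x) + int (color_deg v) - int (card V))
     - (int (deg v) - int (color_deg v)) * (int (card V) + 1 - 2 * int (color_deg v))"

text \<open>With \<open>g = deg v - color_deg v\<close>, replacing \<open>deg v\<close> by \<open>color_deg v\<close> in the bound on third
  vertices costs \<open>deg v * g\<close>, so that the loss at \<open>v\<close> is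
  \<open>2 * g * (g + 1) - deg v * g = g * (deg v + 2 - 2 * color_deg v)\<close>; finally
  \<open>deg v + 1 \<le> card V\<close>.\<close>

lemma net_le:
  assumes "v \<in> V"
  shows "net v \<le> (\<Sum>x\<in>N v. int (card {y \<in> N v \<inter> N x. C {x, y} \<noteq> C {v, x}}))
                  - 2 * int (card (mono_pairs v))"
proof -
  define g where "g = int (deg v) - int (color_deg v)"
  have g: "g \<ge> 0" using color_deg_le_deg[of v] by (simp add: g_def)
  have "int (card (mono_pairs v)) \<le> g * (g + 1)"
  proof -
    have "int (deg v - color_deg v) = g" using color_deg_le_deg[of v] by (simp add: g_def)
    then show ?thesis using card_mono_pairs_le[of v]
      by (metis of_nat_1 of_nat_add of_nat_le_iff of_nat_mult)
  qed
  moreover have "g * (int (deg v) + 1) \<le> g * int (card V)"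
    using g deg_less[OF assms] by (intro mult_left_mono) linarith+
  moreover have "(\<Sum>x\<in>N v. int (color_deg x) + int (color_deg v) - int (card V)) + int (deg v) * g
      = (\<Sum>x\<in>N v. int (color_deg x) + int (deg v) - int (card V))"
    by (simp add: g_def deg_def sum.distrib sum_subtractf algebra_simps)
  moreover have "\<dots> \<le> (\<Sum>x\<in>N v. int (card {y \<in> N v \<inter> N x. C {x, y} \<noteq> C {v, x}}))"
  proof (rule sum_mono)
    fix x assume "x \<in> N v"
    from colors_le_third_vertices[OF this]
    show "int (color_deg x) + int (deg v) - int (card V)
            \<le> int (card {y \<in> N v \<inter> N x. C {x, y} \<noteq> C {v, x}})" by linarith
  qed
  moreover have "int (deg v) * g - 2 * (g * (g + 1)) + g * (int (card V) + 1 - 2 * int (color_deg v))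
      = g * int (card V) - g * (int (deg v) + 1)"
    by (simp add: g_def algebra_simps)
  ultimately show ?thesis unfolding net_def g_def[symmetric] by linarith
qed

lemma sum_net_le_rainbow: "(\<Sum>v\<in>V. net v) \<le> 6 * int (card (rainbow_triangles E C))"
proof -
  let ?T = "\<lambda>v. \<Sum>x\<in>N v. card {y \<in> N v \<inter> N x. C {x, y} \<noteq> C {v, x}}"
  have "(\<Sum>v\<in>V. net v) \<le> (\<Sum>v\<in>V. int (?T v) - 2 * int (card (mono_pairs v)))"
    by (rule sum_mono) (use net_le in simp)
  also have "\<dots> = int (\<Sum>v\<in>V. ?T v) - 2 * int (\<Sum>v\<in>V. card (mono_pairs v))"
    by (simp add: sum_subtractf sum_distrib_left)
  also have "\<dots> \<le> 6 * int (card (rainbow_triangles E C))"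
    using sum_third_vertices_le card_rainbow_triples_le by linarith
  finally show ?thesis .
qed

text \<open>When the colors at \<open>v\<close> are half of \<open>card V\<close> or more, the loss is at most the excess
  \<open>deg v - color_deg v\<close>, while the sum over the neighbors gives at least \<open>deg v\<close>.\<close>

lemma net_ge_color_deg:
  assumes "card V \<le> 2 * color_deg v"
    and "\<And>x. x \<in> N v \<Longrightarrow> card V + 1 \<le> color_deg x + color_deg v"
  shows "int (color_deg v) \<le> net v"
proof -
  have "int (deg v) = (\<Sum>x\<in>N v. 1)" by (simp add: deg_def)
  also have "\<dots> \<le> (\<Sum>x\<in>N v. int (color_deg x) + int (color_deg v) - int (card V))"
    by (rule sum_mono) (use assms(2) in force)
  finally have "int (deg v) \<le> \<dots>" .
  moreover have "(int (deg v) - int (color_deg v)) * (int (card V) + 1 - 2 * int (color_deg v))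
      \<le> int (deg v) - int (color_deg v)"
    using assms(1) color_deg_le_deg[of v] by (intro mult_left_le) linarith+
  ultimately show ?thesis unfolding net_def by linarith
qed

section \<open>The neighborhood union condition\<close>

lemma color_deg_add_adjacent:
  assumes "x \<in> N v" and "n \<le> card (color_nbhd E C x \<union> color_nbhd E C v)"
  shows "n + 1 \<le> color_deg x + color_deg v"
proof -
  have "C {x, v} \<in> color_nbhd E C x"
    unfolding color_nbhd_eq using assms(1) N_sym by (intro imageI) blast
  moreover have "C {v, x} \<in> color_nbhd E C v"
    unfolding color_nbhd_eq using assms(1) by (rule imageI)
  ultimately have "C {v, x} \<in> color_nbhd E C x \<inter> color_nbhd E C v"
    by (simp add: insert_commute)
  then have "card (color_nbhd E C x \<inter> color_nbhd E C v) > 0"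
    using finite_color_nbhd by (subst card_gt_0_iff) blast
  then show ?thesis
    using card_Un_Int[OF finite_color_nbhd finite_color_nbhd, of x v] assms(2)
    by (simp add: color_deg_def)
qed

text \<open>Let \<open>k < card V / 2\<close> be the number of colors at the poor vertex \<open>w\<close>.  Each of the other
  \<open>n - 1\<close> vertices has at least \<open>n - k - 1\<close> neighbors besides \<open>w\<close>, and each of
  these contributes at least \<open>n - 2 * k\<close>.  The loss at \<open>w\<close> is at most
  \<open>(n - k - 1) * (n - 2 * k + 1)\<close>, that is, little more than what a single one of the other
  vertices provides.\<close>

lemma sum_net_ge_poor_vertex:
  assumes w: "w \<in> V" and poor: "2 * color_deg w < card V"
    and union: "\<And>u v. u \<in> V \<Longrightarrow> v \<in> V \<Longrightarrow> u \<noteq> v \<Longrightarrow> card V \<le> color_deg u + color_deg v"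
    and adj: "\<And>x v. v \<in> V \<Longrightarrow> x \<in> N v \<Longrightarrow> card V + 1 \<le> color_deg x + color_deg v"
  shows "(int (card V) - 1 - int (color_deg w))
           * ((int (card V) - 2) * (int (card V) - 2 * int (color_deg w)) - 1) \<le> (\<Sum>v\<in>V. net v)"
proof -
  define n k where "n = int (card V)" and "k = int (color_deg w)"
  have nk: "2 * k < n" "k \<ge> 0" using poor by (auto simp: n_def k_def)
  have rich: "n - k \<le> int (color_deg v)" if "v \<in> V" "v \<noteq> w" for v
    using union[OF that(1) w that(2)] by (simp add: n_def k_def)
  have other: "(n - 1 - k) * (n - 2 * k) \<le> net v" if v: "v \<in> V" "v \<noteq> w" for v
  proof -
    let ?h = "\<lambda>x. int (color_deg x) + int (color_deg v) - n"
    have "n - 1 - k \<le> int (card (N v - {w}))"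
    proof -
      have "deg v \<le> card (N v - {w}) + 1"
        unfolding deg_def using card_Diff_singleton[of w "N v"] by (cases "w \<in> N v") auto
      then show ?thesis using rich[OF v] color_deg_le_deg[of v] by linarith
    qed
    then have "(n - 1 - k) * (n - 2 * k) \<le> int (card (N v - {w})) * (n - 2 * k)"
      using nk by (intro mult_right_mono) auto
    also have "\<dots> = (\<Sum>x\<in>N v - {w}. n - 2 * k)" by simp
    also have "\<dots> \<le> (\<Sum>x\<in>N v - {w}. ?h x)"
    proof (rule sum_mono)
      fix x assume x: "x \<in> N v - {w}"
      then have "x \<in> V" "x \<noteq> w" using N_subset by auto
      then show "n - 2 * k \<le> ?h x" using rich[of x] rich[OF v] by linarith
    qed
    also have "\<dots> \<le> (\<Sum>x\<in>N v. ?h x)"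
    proof (rule sum_mono2)
      fix x assume "x \<in> N v - (N v - {w})"
      then show "0 \<le> ?h x" using adj[OF v(1), of x] by (simp add: n_def)
    qed (auto simp: finite_N)
    finally have "(n - 1 - k) * (n - 2 * k) \<le> (\<Sum>x\<in>N v. ?h x)" .
    moreover have "(int (deg v) - int (color_deg v)) * (n + 1 - 2 * int (color_deg v)) \<le> 0"
      using color_deg_le_deg[of v] rich[OF v] nk by (intro mult_nonneg_nonpos) linarith+
    ultimately show ?thesis unfolding net_def n_def[symmetric] by linarith
  qed
  have at_w: "- ((n - 1 - k) * (n - 2 * k + 1)) \<le> net w"
  proof -
    have "0 \<le> (\<Sum>x\<in>N w. int (color_deg x) + k - n)"
      by (rule sum_nonneg) (use adj[OF w] in \<open>force simp: n_def k_def\<close>)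
    moreover have "(int (deg w) - k) * (n + 1 - 2 * k) \<le> (n - 1 - k) * (n + 1 - 2 * k)"
      using deg_less[OF w] nk by (intro mult_right_mono) (auto simp: n_def)
    moreover have "(n - 1 - k) * (n + 1 - 2 * k) = (n - 1 - k) * (n - 2 * k + 1)"
      by (simp add: algebra_simps)
    ultimately show ?thesis unfolding net_def n_def[symmetric] k_def[symmetric] by linarith
  qed
  have "(n - 1) * ((n - 1 - k) * (n - 2 * k)) = (\<Sum>v\<in>V - {w}. (n - 1 - k) * (n - 2 * k))"
  proof -
    have "card (V - {w}) + 1 = card V" using card_Suc_Diff1[OF finite_V w] by simp
    then have "int (card (V - {w})) = n - 1" by (simp add: n_def)
    then show ?thesis by simp
  qed
  also have "\<dots> \<le> (\<Sum>v\<in>V - {w}. net v)" by (rule sum_mono) (use other in auto)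
  finally have "(n - 1) * ((n - 1 - k) * (n - 2 * k)) - (n - 1 - k) * (n - 2 * k + 1)
      \<le> (\<Sum>v\<in>V - {w}. net v) + net w" using at_w by linarith
  also have "\<dots> = (\<Sum>v\<in>V. net v)" using sum.remove[OF finite_V w, of net] by simp
  finally show ?thesis unfolding n_def[symmetric] k_def[symmetric] by (simp add: algebra_simps)
qed

end

text \<open>The poor vertex bound suffices: \<open>n - 1 - k \<ge> (n - 1) / 2\<close> and \<open>n - 2 * k \<ge> 1\<close>.  The
  resulting \<open>(n - 1) * (n - 3) / 2\<close> beats the target from \<open>n = 5\<close> on; for \<open>n = 4\<close>
  parity gives \<open>n - 2 * k \<ge> 2\<close>.\<close>

lemma poor_vertex_bound_ge:
  fixes n k :: int
  assumes n: "4 \<le> n" and k: "2 * k < n" "0 \<le> k"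
  shows "n\<^sup>2 - 2 * n \<le> 4 * ((n - 1 - k) * ((n - 2) * (n - 2 * k) - 1))"
proof (cases "n = 4")
  case True
  then have "k = 0 \<or> k = 1" using k by linarith
  then show ?thesis using True by auto
next
  case False
  define m where "m = (n - 2) * (n - 2 * k)"
  have "(n - 2) * 1 \<le> m" unfolding m_def using n k by (intro mult_left_mono) linarith+
  then have "n - 3 \<le> m - 1" by simp
  moreover have "n - 1 \<le> 2 * (n - 1 - k)" using k by simp
  ultimately have "(n - 1) * (n - 3) \<le> (2 * (n - 1 - k)) * (m - 1)"
    using n by (intro mult_mono) simp_all
  moreover have "0 \<le> (n - 5) * (n - 1)" using False n by (intro mult_nonneg_nonneg) linarith+
  ultimately have "n * n - 2 * n \<le> 4 * ((n - 1 - k) * (m - 1))"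
    using n by (simp add: algebra_simps)
  then show ?thesis unfolding m_def power2_eq_square .
qed

theorem theorem6:
  fixes V :: "'a set" and E :: "'a set set" and C :: "'a set \<Rightarrow> nat" and n :: nat
  assumes "simple_graph V E"
    and "card V = n"
    and "n \<ge> 4"
    and "\<And>u v. u \<in> V \<Longrightarrow> v \<in> V \<Longrightarrow> u \<noteq> v \<Longrightarrow>
           card (color_nbhd E C u \<union> color_nbhd E C v) \<ge> n"
  shows "real (card (rainbow_triangles E C)) \<ge> ((real n)^2 - 2 * real n) / 24"
proof -
  interpret edge_colored_graph V E C using assms(1) by unfold_locales
  let ?R = "int (card (rainbow_triangles E C))"
  have union: "card V \<le> color_deg u + color_deg v" if "u \<in> V" "v \<in> V" "u \<noteq> v" for u v
    using assms(4)[OF that] card_Un_le[of "color_nbhd E C u" "color_nbhd E C v"] assms(2)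
    unfolding color_deg_def by linarith
  have adj: "card V + 1 \<le> color_deg x + color_deg v" if "v \<in> V" "x \<in> N v" for x v
  proof -
    have "x \<in> V" "x \<noteq> v" using that N_subset not_in_own_N by auto
    from assms(4)[OF this(1) that(1) this(2)] show ?thesis
      unfolding assms(2) by (rule color_deg_add_adjacent[OF that(2)])
  qed
  have "(int n)\<^sup>2 - 2 * int n \<le> 4 * (\<Sum>v\<in>V. net v)"
  proof (cases "\<exists>w\<in>V. 2 * color_deg w < card V")
    case True
    then obtain w where w: "w \<in> V" "2 * color_deg w < card V" by blast
    show ?thesis
      using sum_net_ge_poor_vertex[OF w union adj] poor_vertex_bound_ge[of "int n" "int (color_deg w)"]
        assms(2,3) w(2) by fastforce
  next
    case False
    have "int n * int n = (\<Sum>v\<in>V. int n)" using assms(2) by simp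
    also have "\<dots> \<le> (\<Sum>v\<in>V. 2 * net v)"
    proof (rule sum_mono)
      fix v assume v: "v \<in> V"
      then have "card V \<le> 2 * color_deg v" using False by force
      then show "int n \<le> 2 * net v" using net_ge_color_deg[of v] adj[OF v] assms(2) by force
    qed
    also have "\<dots> = 2 * (\<Sum>v\<in>V. net v)" by (simp add: sum_distrib_left)
    finally have "int n * int n \<le> 2 * (\<Sum>v\<in>V. net v)" .
    moreover have "0 \<le> int n * int n" by simp
    ultimately show ?thesis unfolding power2_eq_square by linarith
  qed
  then have "(int n)\<^sup>2 - 2 * int n \<le> 24 * ?R" using sum_net_le_rainbow by linarith
  then have "real_of_int ((int n)\<^sup>2 - 2 * int n) \<le> real_of_int (24 * ?R)" by (rule of_int_le_iff[THEN iffD2])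
  then show ?thesis by simp
qed

end
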